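(* Let $P$ be a prod-complex on sets $I_1,\dots,I_m$. Then the squashing map $\xi_P : |\mathrm{simp}(P)|\to|P|$ is a homotopy equivalence.
   Context: For a set $I$, $\Delta I$ denotes the set of all non-empty finite subsets of $I$, partially ordered by inclusion. A prod-complex on $I_1,\dots,I_m$ is a downwardly closed subset $P$ of the product poset $\Delta I_1\times\dots\times\Delta I_m$; its elements $\sigma=(\sigma_1,\dots,\sigma_m)$ are prod-simplices. A simplicial complex on $I$ is a prod-complex of order $m=1$. Geometric realization: $\mathbb{R}_I$ is the real vector space of families $(x_i)_{i\in I}$ with finitely many non-zero entries, with the direct-limit topology (a set is closed iff its intersection with $\mathbb{R}_F$ is closed for each finite $F\subseteq I$), and $\varepsilon(i)$ is the standard basis vector of $i$. For $\sigma\in\Delta I$, $|\sigma|=\mathrm{conv}\{\varepsilon(i)\mid i\in\sigma\}$. For a prod-simplex, $|\sigma|=|\sigma_1|\times\dots\times|\sigma_m|$, and $|P|=\bigcup_{\sigma\in P}|\sigma|$, a subcomplex of the CW-complex $|\Delta I_1|\times\dots\times|\Delta I_m|$. Products are taken in compactly generated Hausdorff spaces; equivalently, a subset of $|P|$ is closed iff its intersection with each closed cell $|\sigma|$, $\sigma\in P$, is closed. Simplexification: $\mathrm{simp}(P)$ is the simplicial complex on $I_1\times\dots\times I_m$ whose simplices are the non-empty finite sets $\rho\subseteq I_1\times\dots\times I_m$ for which there exists $(\sigma_1,\dots,\sigma_m)\in P$ with $\rho\subseteq\sigma_1\times\dots\times\sigma_m$. Squashing map: let $\xi : \mathbb{R}_{I_1\times\dots\times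 I_m}\to\mathbb{R}_{I_1}\times\dots\times\mathbb{R}_{I_m}$ be the linear map with $\xi(\varepsilon((i_1,\dots,i_m))) = (\varepsilon(i_1),\dots,\varepsilon(i_m))$. Then $\xi_P:|\mathrm{simp}(P)|\to|P|$ is the restriction of $\xi$. *)

theory Defs
  imports "HOL-Analysis.Analysis" "HOL-Analysis.Finite_Function_Topology"
begin

text \<open>
  The factors \<open>I\<^sub>1, \<dots>, I\<^sub>m\<close> are a family \<open>I :: 'm \<Rightarrow> 'a set\<close> over a finite index type, and
  \<open>I\<^sub>1 \<times> \<dots> \<times> I\<^sub>m\<close> is \<open>Pi UNIV I\<close>.  Taking all \<open>I j\<close> inside one type is no restriction:
  sets from different types embed into the sum type.
\<close>

definition simplices :: "'a set \<Rightarrow> 'a set set" where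
  "simplices I = {\<sigma>. finite \<sigma> \<and> \<sigma> \<noteq> {} \<and> \<sigma> \<subseteq> I}"

text \<open>The order on \<^typ>\<open>'m \<Rightarrow> 'a set\<close> is componentwise inclusion.\<close>

definition prod_complex :: "('m::finite \<Rightarrow> 'a set) \<Rightarrow> ('m \<Rightarrow> 'a set) set \<Rightarrow> bool" where
  "prod_complex I P \<longleftrightarrow>
     P \<subseteq> Pi UNIV (\<lambda>j. simplices (I j)) \<and>
     (\<forall>\<sigma>\<in>P. \<forall>\<tau>\<in>Pi UNIV (\<lambda>j. simplices (I j)). \<tau> \<le> \<sigma> \<longrightarrow> \<tau> \<in> P)"

definition simplicial_complex :: "'a set \<Rightarrow> 'a set set \<Rightarrow> bool" where
  "simplicial_complex I K \<longleftrightarrow>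
     K \<subseteq> simplices I \<and> (\<forall>\<sigma>\<in>K. \<forall>\<tau>\<in>simplices I. \<tau> \<subseteq> \<sigma> \<longrightarrow> \<tau> \<in> K)"

definition simplexification ::
    "('m::finite \<Rightarrow> 'a set) \<Rightarrow> ('m \<Rightarrow> 'a set) set \<Rightarrow> ('m \<Rightarrow> 'a) set set" where
  "simplexification I P = {\<rho> \<in> simplices (Pi UNIV I). \<exists>\<sigma>\<in>P. \<rho> \<subseteq> Pi UNIV \<sigma>}"

lemma simplicial_complex_simplexification: "simplicial_complex (Pi UNIV I) (simplexification I P)"
  unfolding simplicial_complex_def simplexification_def by blast


text \<open>The topology on \<open>\<Union>\<C>\<close> in which a set is open (equivalently, closed) iff its trace on
  each \<open>C \<in> \<C>\<close> is open (closed) in \<open>C\<close>, where \<open>C\<close> carries the subspace topology from \<open>X\<close>.\<close>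

definition coherent_topology :: "'b topology \<Rightarrow> 'b set set \<Rightarrow> 'b topology" where
  "coherent_topology X \<C> =
     topology (\<lambda>U. U \<subseteq> \<Union>\<C> \<and> (\<forall>C\<in>\<C>. openin (subtopology X C) (U \<inter> C)))"

lemma openin_coherent_topology:
  "openin (coherent_topology X \<C>) U \<longleftrightarrow>
     U \<subseteq> \<Union>\<C> \<and> (\<forall>C\<in>\<C>. openin (subtopology X C) (U \<inter> C))"
proof -
  have "istopology (\<lambda>U. U \<subseteq> \<Union>\<C> \<and> (\<forall>C\<in>\<C>. openin (subtopology X C) (U \<inter> C)))"
    unfolding istopology_def
  proof (intro conjI allI impI ballI)
    fix S T C
    assume "S \<subseteq> \<Union>\<C> \<and> (\<forall>C\<in>\<C>. openin (subtopology X C) (S \<inter> C))"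
      and "T \<subseteq> \<Union>\<C> \<and> (\<forall>C\<in>\<C>. openin (subtopology X C) (T \<inter> C))" and "C \<in> \<C>"
    then have "openin (subtopology X C) ((S \<inter> C) \<inter> (T \<inter> C))" by blast
    moreover have "(S \<inter> C) \<inter> (T \<inter> C) = S \<inter> T \<inter> C" by blast
    ultimately show "openin (subtopology X C) (S \<inter> T \<inter> C)" by simp
  next
    fix \<K> C
    assume "\<forall>K\<in>\<K>. K \<subseteq> \<Union>\<C> \<and> (\<forall>C\<in>\<C>. openin (subtopology X C) (K \<inter> C))" and "C \<in> \<C>"
    then have "openin (subtopology X C) (\<Union>K\<in>\<K>. K \<inter> C)" by blast
    moreover have "(\<Union>K\<in>\<K>. K \<inter> C) = \<Union>\<K> \<inter> C" by blast
    ultimately show "openin (subtopology X C) (\<Union>\<K> \<inter> C)" by simp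
  qed blast+
  then show ?thesis by (simp add: coherent_topology_def)
qed

lemma topspace_coherent_topology:
  assumes "\<Union>\<C> \<subseteq> topspace X"
  shows "topspace (coherent_topology X \<C>) = \<Union>\<C>"
proof -
  have "openin (subtopology X C) (\<Union>\<C> \<inter> C)" if "C \<in> \<C>" for C
  proof -
    have "topspace (subtopology X C) = \<Union>\<C> \<inter> C" using assms that by auto
    then show ?thesis by (metis openin_topspace)
  qed
  then show ?thesis
    unfolding topspace_def openin_coherent_topology by blast
qed

lemma closedin_coherent_topology:
  assumes "\<Union>\<C> \<subseteq> topspace X"
  shows "closedin (coherent_topology X \<C>) A \<longleftrightarrow>
     A \<subseteq> \<Union>\<C> \<and> (\<forall>C\<in>\<C>. closedin (subtopology X C) (A \<inter> C))"
proof -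
  have "openin (subtopology X C) ((\<Union>\<C> - A) \<inter> C) \<longleftrightarrow> closedin (subtopology X C) (A \<inter> C)"
    if "C \<in> \<C>" for C
  proof -
    have "topspace (subtopology X C) = C" using assms that by auto
    moreover have "C - A \<inter> C = (\<Union>\<C> - A) \<inter> C" using that by blast
    ultimately show ?thesis by (simp add: closedin_def)
  qed
  then show ?thesis
    by (auto simp: closedin_def[of "coherent_topology X \<C>"] openin_coherent_topology
        topspace_coherent_topology[OF assms])
qed


text \<open>
  The norm topology on \<^typ>\<open>'a \<Rightarrow>\<^sub>0 real\<close> is not the direct-limit topology, but on \<open>fin_vecs F\<close>
  with \<open>F\<close> finite it is the usual topology of a finite-dimensional space.
\<close>

definition fin_vecs :: "'a set \<Rightarrow> ('a \<Rightarrow>\<^sub>0 real) set" where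
  "fin_vecs I = {x. Poly_Mapping.keys x \<subseteq> I}"

definition fin_vecs_topology :: "'a set \<Rightarrow> ('a \<Rightarrow>\<^sub>0 real) topology" where
  "fin_vecs_topology I = coherent_topology euclidean {fin_vecs F |F. finite F \<and> F \<subseteq> I}"

lemma topspace_fin_vecs_topology: "topspace (fin_vecs_topology I) = fin_vecs I"
proof -
  have "\<Union>{fin_vecs F |F. finite F \<and> F \<subseteq> I} = fin_vecs I"
    unfolding fin_vecs_def using finite_keys by blast
  then show ?thesis
    by (simp add: fin_vecs_topology_def topspace_coherent_topology)
qed

definition basis_vec :: "'a \<Rightarrow> ('a \<Rightarrow>\<^sub>0 real)" where
  "basis_vec i = Poly_Mapping.single i 1"

definition simplex_realization :: "'a set \<Rightarrow> ('a \<Rightarrow>\<^sub>0 real) set" where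
  "simplex_realization \<sigma> = convex hull (basis_vec ` \<sigma>)"

definition prod_simplex_realization :: "('m::finite \<Rightarrow> 'a set) \<Rightarrow> ('m \<Rightarrow> ('a \<Rightarrow>\<^sub>0 real)) set" where
  "prod_simplex_realization \<sigma> = Pi UNIV (\<lambda>j. simplex_realization (\<sigma> j))"

text \<open>
  The ambient product topology is used only to topologise the individual closed cells, which are
  compact subsets of finite-dimensional spaces; hence it does not matter that it need not be
  compactly generated.
\<close>

definition realization :: "'a set \<Rightarrow> 'a set set \<Rightarrow> ('a \<Rightarrow>\<^sub>0 real) topology" where
  "realization I K = coherent_topology (fin_vecs_topology I) (simplex_realization ` K)"

definition prod_realization ::
    "('m::finite \<Rightarrow> 'a set) \<Rightarrow> ('m \<Rightarrow> 'a set) set \<Rightarrow> ('m \<Rightarrow> ('a \<Rightarrow>\<^sub>0 real)) topology" where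
  "prod_realization I P =
     coherent_topology (product_topology (\<lambda>j. fin_vecs_topology (I j)) UNIV)
       (prod_simplex_realization ` P)"

lemma simplex_realization_subset:
  assumes "\<sigma> \<subseteq> I" shows "simplex_realization \<sigma> \<subseteq> fin_vecs I"
  unfolding simplex_realization_def
proof (rule hull_minimal)
  show "basis_vec ` \<sigma> \<subseteq> fin_vecs I"
    using assms by (auto simp: basis_vec_def fin_vecs_def)
  show "convex (fin_vecs I)"
  proof (rule convexI)
    fix x y :: "'a \<Rightarrow>\<^sub>0 real" and u v :: real
    assume xy: "x \<in> fin_vecs I" "y \<in> fin_vecs I"
    have "Poly_Mapping.lookup (u *\<^sub>R x + v *\<^sub>R y) i = 0" if "i \<notin> I" for i
    proof -
      have "Poly_Mapping.lookup x i = 0" "Poly_Mapping.lookup y i = 0"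
        using xy that by (auto simp: fin_vecs_def in_keys_iff)
      then show ?thesis by (simp add: lookup_add scaleR_poly_mapping_def)
    qed
    then show "u *\<^sub>R x + v *\<^sub>R y \<in> fin_vecs I"
      unfolding fin_vecs_def by (auto simp: in_keys_iff)
  qed
qed

lemma topspace_realization:
  assumes "simplicial_complex I K"
  shows "topspace (realization I K) = (\<Union>\<sigma>\<in>K. simplex_realization \<sigma>)"
proof -
  have "\<sigma> \<subseteq> I" if "\<sigma> \<in> K" for \<sigma>
    using assms that by (auto simp: simplicial_complex_def simplices_def)
  then have "(\<Union>\<sigma>\<in>K. simplex_realization \<sigma>) \<subseteq> fin_vecs I"
    by (intro UN_least simplex_realization_subset)
  then show ?thesis
    by (simp add: realization_def topspace_coherent_topology topspace_fin_vecs_topology)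
qed

lemma topspace_prod_realization:
  assumes "prod_complex I P"
  shows "topspace (prod_realization I P) = (\<Union>\<sigma>\<in>P. prod_simplex_realization \<sigma>)"
proof -
  have "prod_simplex_realization \<sigma> \<subseteq> Pi UNIV (\<lambda>j. fin_vecs (I j))" if "\<sigma> \<in> P" for \<sigma>
  proof -
    have "\<sigma> j \<subseteq> I j" for j
      using assms that by (auto simp: prod_complex_def simplices_def Pi_iff)
    then show ?thesis
      unfolding prod_simplex_realization_def by (intro Pi_mono simplex_realization_subset)
  qed
  then show ?thesis
    unfolding prod_realization_def
    by (subst topspace_coherent_topology)
      (auto simp: topspace_fin_vecs_topology PiE_UNIV_domain)
qed


text \<open>The linear map \<open>\<xi>\<close>, written out in coordinates.\<close>

definition squash :: "(('m::finite \<Rightarrow> 'a) \<Rightarrow>\<^sub>0 real) \<Rightarrow> 'm \<Rightarrow> ('a \<Rightarrow>\<^sub>0 real)" where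
  "squash x = (\<lambda>j. \<Sum>i\<in>Poly_Mapping.keys x. Poly_Mapping.lookup x i *\<^sub>R basis_vec (i j))"

lemma squash_basis_vec: "squash (basis_vec i) = (\<lambda>j. basis_vec (i j))"
  by (simp add: squash_def basis_vec_def)

lemma linear_squash: "linear (\<lambda>x. squash x j)"
proof -
  have *: "squash x j = (\<Sum>i\<in>S. Poly_Mapping.lookup x i *\<^sub>R basis_vec (i j))"
    if "finite S" "Poly_Mapping.keys x \<subseteq> S" for x :: "('a \<Rightarrow> 'b) \<Rightarrow>\<^sub>0 real" and S
    unfolding squash_def using that by (intro sum.mono_neutral_left) (auto simp: in_keys_iff)
  have lookup_scaleR: "Poly_Mapping.lookup (c *\<^sub>R x) i = c * Poly_Mapping.lookup x i"
    for c and x :: "('a \<Rightarrow> 'b) \<Rightarrow>\<^sub>0 real" and i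
    by (simp add: scaleR_poly_mapping_def)
  show ?thesis
  proof (rule linearI)
    fix x y :: "('a \<Rightarrow> 'b) \<Rightarrow>\<^sub>0 real" and c :: real
    let ?S = "Poly_Mapping.keys x \<union> Poly_Mapping.keys y"
    have "Poly_Mapping.keys (x + y) \<subseteq> ?S" by (rule keys_add)
    then show "squash (x + y) j = squash x j + squash y j"
      by (simp add: *[of ?S] lookup_add scaleR_add_left sum.distrib)
    have "Poly_Mapping.keys (c *\<^sub>R x) \<subseteq> Poly_Mapping.keys x"
      by (auto simp: in_keys_iff lookup_scaleR)
    then show "squash (c *\<^sub>R x) j = c *\<^sub>R squash x j"
      by (simp add: *[of "Poly_Mapping.keys x"] lookup_scaleR scaleR_sum_right)
  qed
qed

definition squashing_map ::
    "('m::finite \<Rightarrow> 'a set) \<Rightarrow> ('m \<Rightarrow> 'a set) set \<Rightarrow> (('m \<Rightarrow> 'a) \<Rightarrow>\<^sub>0 real) \<Rightarrow> 'm \<Rightarrow> ('a \<Rightarrow>\<^sub>0 real)"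
  where
  "squashing_map I P = restrict squash (\<Union>\<rho>\<in>simplexification I P. simplex_realization \<rho>)"


definition homotopy_equivalence :: "'b topology \<Rightarrow> 'c topology \<Rightarrow> ('b \<Rightarrow> 'c) \<Rightarrow> bool" where
  "homotopy_equivalence X Y f \<longleftrightarrow>
     continuous_map X Y f \<and>
     (\<exists>g. continuous_map Y X g \<and>
          homotopic_with (\<lambda>_. True) X X (g \<circ> f) id \<and>
          homotopic_with (\<lambda>_. True) Y Y (f \<circ> g) id)"

end

theory Submission
  imports Defs
begin

text \<open>
  A point of a simplex is a finitely supported probability distribution on its vertices, and the
  squashing map sends a joint distribution on \<open>I\<^sub>1 \<times> \<dots> \<times> I\<^sub>m\<close> to the family of its marginals.
  Forming the product of independent distributions (\<open>independent_coupling\<close>) goes back, from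
  \<open>\<bar>\<sigma>\<bar>\<close> to the realization of the full simplex on the finite vertex set
  \<open>\<sigma>\<^sub>1 \<times> \<dots> \<times> \<sigma>\<^sub>m\<close>, which belongs to the simplexification.  The marginals of a product
  distribution are its factors (\<open>squash_independent_coupling\<close>), so this is a section of the
  squashing map.  In the other order, a distribution carried by \<open>\<rho> \<subseteq> \<sigma>\<^sub>1 \<times> \<dots> \<times> \<sigma>\<^sub>m\<close> and the
  product of its marginals both lie in the convex set \<open>\<bar>\<sigma>\<^sub>1 \<times> \<dots> \<times> \<sigma>\<^sub>m\<bar>\<close>, and the straight
  segment between them is the required homotopy.

  On a single closed cell all these maps are polynomial in the coordinates, hence continuous.  Maps
  out of the coherent topology are continuous as soon as they are so on cells.  For the homotopy
  the same is needed on \<open>[0,1] \<times> \<bar>simp(P)\<bar>\<close>, and there it rests on local compactness of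
  \<open>[0,1]\<close> (\<open>continuous_map_prod_coherent_topology\<close>).
\<close>

section \<open>Coherent topologies\<close>

text \<open>
  Each \<open>C \<in> \<C>\<close> keeps its original topology, because an open set of \<open>X\<close> has open traces on all
  members of \<open>\<C>\<close>.  Consequently a map into a realization that stays in one cell is continuous
  as soon as it is continuous into that cell.
\<close>

lemma subtopology_coherent_topology:
  assumes "C \<in> \<C>"
  shows "subtopology (coherent_topology X \<C>) C = subtopology X C"
proof (rule topology_eq[THEN iffD2], intro allI iffI)
  fix U
  assume "openin (subtopology (coherent_topology X \<C>) C) U"
  then show "openin (subtopology X C) U"
    using assms by (auto simp: openin_subtopology[of "coherent_topology X \<C>"] openin_coherent_topology)
next
  fix U
  assume "openin (subtopology X C) U"
  then obtain T where T: "openin X T" "U = T \<inter> C"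
    by (auto simp: openin_subtopology)
  have "openin (subtopology X D) (T \<inter> \<Union>\<C> \<inter> D)" if "D \<in> \<C>" for D
  proof -
    have "T \<inter> \<Union>\<C> \<inter> D = T \<inter> D" using that by blast
    then show ?thesis using T(1) by (auto simp: openin_subtopology)
  qed
  then have "openin (coherent_topology X \<C>) (T \<inter> \<Union>\<C>)"
    by (auto simp: openin_coherent_topology)
  moreover have "U = T \<inter> \<Union>\<C> \<inter> C" using T(2) assms by blast
  ultimately show "openin (subtopology (coherent_topology X \<C>) C) U"
    by (auto simp: openin_subtopology)
qed

lemma continuous_map_coherent_topology:
  assumes "\<Union>\<C> \<subseteq> topspace X"
    and f: "\<And>C. C \<in> \<C> \<Longrightarrow> continuous_map (subtopology X C) Y f"
  shows "continuous_map (coherent_topology X \<C>) Y f"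
proof -
  have top: "topspace (subtopology X C) = C" if "C \<in> \<C>" for C
    using assms(1) that by auto
  have "openin (subtopology X C) ({x \<in> \<Union>\<C>. f x \<in> U} \<inter> C)" if "C \<in> \<C>" "openin Y U" for C U
  proof -
    have "{x \<in> \<Union>\<C>. f x \<in> U} \<inter> C = {x \<in> C. f x \<in> U}" using that by blast
    then show ?thesis
      using openin_continuous_map_preimage[OF f[OF that(1)] that(2)] unfolding top[OF that(1)] by simp
  qed
  moreover have "f \<in> \<Union>\<C> \<rightarrow> topspace Y"
    using f top by (fastforce simp: continuous_map_def)
  ultimately show ?thesis
    by (auto simp: continuous_map_def topspace_coherent_topology[OF assms(1)] openin_coherent_topology)
qed

text \<open>
  If \<open>W\<close> is the preimage of an open set and \<open>(z, x) \<in> W\<close>, then \<open>z\<close> has a compact neighbourhood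
  \<open>K\<close> with \<open>K \<times> {x} \<subseteq> W\<close>.  By the tube lemma in each \<open>Z \<times> C\<close>, the set of all \<open>y\<close> with
  \<open>K \<times> {y} \<subseteq> W\<close> has an open trace on every \<open>C\<close>, so it is open; its product with the interior
  of \<open>K\<close> is a neighbourhood of \<open>(z, x)\<close> inside \<open>W\<close>.
\<close>

lemma continuous_map_prod_coherent_topology:
  assumes sub: "\<Union>\<C> \<subseteq> topspace X"
    and Z: "locally_compact_space Z" "Hausdorff_space Z \<or> regular_space Z"
    and f: "\<And>C. C \<in> \<C> \<Longrightarrow> continuous_map (prod_topology Z (subtopology X C)) Y f"
  shows "continuous_map (prod_topology Z (coherent_topology X \<C>)) Y f"
proof -
  have top: "topspace (subtopology X C) = C" if "C \<in> \<C>" for C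
    using sub that by auto
  have topc: "topspace (coherent_topology X \<C>) = \<Union>\<C>"
    by (rule topspace_coherent_topology[OF sub])
  have "openin (prod_topology Z (coherent_topology X \<C>)) {p \<in> topspace Z \<times> \<Union>\<C>. f p \<in> U}"
    (is "openin _ ?W") if U: "openin Y U" for U
    unfolding openin_prod_topology_alt
  proof (intro allI impI)
    fix z x
    assume zx: "(z, x) \<in> ?W"
    then obtain C where C: "C \<in> \<C>" "x \<in> C" by blast
    have WC: "openin (prod_topology Z (subtopology X D)) {p \<in> topspace Z \<times> D. f p \<in> U}"
      if "D \<in> \<C>" for D
      using openin_continuous_map_preimage[OF f[OF that] U]
      unfolding topspace_prod_topology top[OF that] by simp
    have "openin Z {s \<in> topspace Z. f (s, x) \<in> U}"
    proof -
      have "continuous_map Z (prod_topology Z (subtopology X C)) (\<lambda>s. (s, x))"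
        using C top[OF C(1)] by (auto intro!: continuous_intros)
      from continuous_map_compose[OF this f[OF C(1)]] U show ?thesis
        by (auto simp: continuous_map o_def)
    qed
    moreover have "neighbourhood_base_of (compactin Z) Z"
      using Z locally_compact_space_neighbourhood_base by blast
    moreover have "z \<in> {s \<in> topspace Z. f (s, x) \<in> U}"
      using zx by auto
    ultimately obtain O' K where K: "openin Z O'" "compactin Z K" "z \<in> O'" "O' \<subseteq> K"
      "K \<subseteq> {s \<in> topspace Z. f (s, x) \<in> U}"
      unfolding neighbourhood_base_of by meson
    define V where "V = {y \<in> \<Union>\<C>. \<forall>s\<in>K. f (s, y) \<in> U}"
    have "openin (subtopology X D) (V \<inter> D)" if D: "D \<in> \<C>" for D
    proof (subst openin_subopen, intro ballI)
      fix y assume y: "y \<in> V \<inter> D"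
      have "K \<times> {y} \<subseteq> {p \<in> topspace Z \<times> D. f p \<in> U}"
        using y K(5) by (auto simp: V_def)
      moreover have "y \<in> topspace (subtopology X D)"
        using y top[OF D] by simp
      ultimately obtain A B where AB: "openin (subtopology X D) B" "K \<subseteq> A" "y \<in> B"
        "A \<times> B \<subseteq> {p \<in> topspace Z \<times> D. f p \<in> U}"
        using tube_lemma_left[OF WC[OF D] K(2)] by meson
      have "B \<subseteq> D" using openin_subset[OF AB(1)] top[OF D] by simp
      moreover have "f (s, b) \<in> U" if "s \<in> K" "b \<in> B" for s b
        using AB(2,4) that by blast
      ultimately have "B \<subseteq> V \<inter> D" using D by (auto simp: V_def)
      with AB show "\<exists>T. openin (subtopology X D) T \<and> y \<in> T \<and> T \<subseteq> V \<inter> D" by blast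
    qed
    then have "openin (coherent_topology X \<C>) V"
      by (auto simp: openin_coherent_topology V_def)
    moreover have "x \<in> V" using C K(5) by (auto simp: V_def)
    moreover have "O' \<times> V \<subseteq> ?W" using K(4,5) by (auto simp: V_def)
    ultimately show "\<exists>A B. openin Z A \<and> openin (coherent_topology X \<C>) B \<and> z \<in> A \<and> x \<in> B \<and> A \<times> B \<subseteq> ?W"
      using K(1,3) by blast
  qed
  moreover have "f \<in> topspace Z \<times> \<Union>\<C> \<rightarrow> topspace Y"
    using f top by (fastforce simp: continuous_map_def)
  ultimately show ?thesis
    by (auto simp: continuous_map_def topc)
qed

section \<open>Coordinates of finitely supported vectors\<close>

lemma lookup_scaleR:
  fixes x :: "'a \<Rightarrow>\<^sub>0 real"
  shows "Poly_Mapping.lookup (c *\<^sub>R x) i = c * Poly_Mapping.lookup x i"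
  by (simp add: scaleR_poly_mapping_def)

lemma lookup_basis_vec: "Poly_Mapping.lookup (basis_vec i) k = (if k = i then 1 else 0)"
  by (auto simp: basis_vec_def lookup_single when_def)

lemma sum_lookup_scaleR_basis_vec:
  assumes "finite S" "Poly_Mapping.keys x \<subseteq> S"
  shows "(\<Sum>i\<in>S. Poly_Mapping.lookup x i *\<^sub>R basis_vec i) = x"
proof (rule poly_mapping_eqI)
  fix k
  show "Poly_Mapping.lookup (\<Sum>i\<in>S. Poly_Mapping.lookup x i *\<^sub>R basis_vec i) k
    = Poly_Mapping.lookup x k"
    using assms by (auto simp: lookup_sum lookup_scaleR lookup_basis_vec sum.delta in_keys_iff
        if_distrib[of "\<lambda>t. _ * t"] cong: if_cong)
qed

lemma abs_lookup_le_norm: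
  fixes x :: "'a \<Rightarrow>\<^sub>0 real"
  shows "\<bar>Poly_Mapping.lookup x i\<bar> \<le> norm x"
proof (cases "i \<in> Poly_Mapping.keys x")
  case True
  then have "\<bar>Poly_Mapping.lookup x i\<bar> \<le> (\<Sum>k\<in>Poly_Mapping.keys x. \<bar>Poly_Mapping.lookup x k\<bar>)"
    by (intro member_le_sum) auto
  then show ?thesis
    by (simp add: norm_poly_mapping_def dist_poly_mapping_def)
qed (simp add: in_keys_iff)

lemma bounded_linear_lookup: "bounded_linear (\<lambda>x :: 'a \<Rightarrow>\<^sub>0 real. Poly_Mapping.lookup x i)"
  by (rule bounded_linear_intro[where K = 1])
    (simp_all add: lookup_add lookup_scaleR abs_lookup_le_norm)

lemma continuous_on_lookup: "continuous_on S (\<lambda>x :: 'a \<Rightarrow>\<^sub>0 real. Poly_Mapping.lookup x i)"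
  by (rule linear_continuous_on[OF bounded_linear_lookup])

lemma simplex_realization_eq:
  assumes "finite \<sigma>"
  shows "simplex_realization \<sigma> =
    {x. Poly_Mapping.keys x \<subseteq> \<sigma> \<and> (\<forall>i. 0 \<le> Poly_Mapping.lookup x i) \<and>
        (\<Sum>i\<in>\<sigma>. Poly_Mapping.lookup x i) = 1}" (is "_ = ?D")
proof
  have "convex ?D"
  proof (rule convexI)
    fix x y :: "'a \<Rightarrow>\<^sub>0 real" and u v :: real
    assume xy: "x \<in> ?D" "y \<in> ?D" and uv: "0 \<le> u" "0 \<le> v" "u + v = 1"
    have "Poly_Mapping.lookup (u *\<^sub>R x + v *\<^sub>R y) i = 0" if "i \<notin> \<sigma>" for i
    proof -
      have "Poly_Mapping.lookup x i = 0" "Poly_Mapping.lookup y i = 0"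
        using xy that by (auto simp: in_keys_iff)
      then show ?thesis by (simp add: lookup_add lookup_scaleR)
    qed
    then have "Poly_Mapping.keys (u *\<^sub>R x + v *\<^sub>R y) \<subseteq> \<sigma>" by (auto simp: in_keys_iff)
    then show "u *\<^sub>R x + v *\<^sub>R y \<in> ?D"
      using xy uv by (simp add: lookup_add lookup_scaleR sum.distrib flip: sum_distrib_left)
  qed
  moreover have "basis_vec ` \<sigma> \<subseteq> ?D"
    using assms by (auto simp: lookup_basis_vec in_keys_iff split: if_splits)
  ultimately show "simplex_realization \<sigma> \<subseteq> ?D"
    unfolding simplex_realization_def by (intro hull_minimal)
next
  show "?D \<subseteq> simplex_realization \<sigma>"
  proof
    fix x assume x: "x \<in> ?D"
    have "(\<Sum>i\<in>\<sigma>. Poly_Mapping.lookup x i *\<^sub>R basis_vec i) \<in> simplex_realization \<sigma>"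
      unfolding simplex_realization_def
      using x assms by (intro convex_sum) (auto intro: hull_inc)
    then show "x \<in> simplex_realization \<sigma>"
      using x assms by (simp add: sum_lookup_scaleR_basis_vec)
  qed
qed

section \<open>Closed cells of the realizations\<close>

text \<open>
  The simplex lies in the finite-dimensional space \<open>fin_vecs \<sigma>\<close>, where the direct-limit topology
  and the norm topology agree.  Continuity on cells can therefore be checked for the norm.
\<close>

lemma subtopology_fin_vecs_topology_simplex:
  assumes "finite \<sigma>" "\<sigma> \<subseteq> I"
  shows "subtopology (fin_vecs_topology I) (simplex_realization \<sigma>) = top_of_set (simplex_realization \<sigma>)"
proof -
  have "subtopology (fin_vecs_topology I) (fin_vecs \<sigma>) = top_of_set (fin_vecs \<sigma>)"
    unfolding fin_vecs_topology_def using assms by (intro subtopology_coherent_topology) blast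
  then have "subtopology (subtopology (fin_vecs_topology I) (fin_vecs \<sigma>)) (simplex_realization \<sigma>)
      = subtopology (top_of_set (fin_vecs \<sigma>)) (simplex_realization \<sigma>)"
    by simp
  moreover have "fin_vecs \<sigma> \<inter> simplex_realization \<sigma> = simplex_realization \<sigma>"
    using simplex_realization_subset[of \<sigma> \<sigma>] by blast
  ultimately show ?thesis by (simp add: subtopology_subtopology)
qed

lemma subtopology_product_fin_vecs_topology:
  assumes "\<And>j. finite (\<sigma> j)" "\<And>j. \<sigma> j \<subseteq> I j"
  shows "subtopology (product_topology (\<lambda>j. fin_vecs_topology (I j)) UNIV) (prod_simplex_realization \<sigma>)
    = product_topology (\<lambda>j. top_of_set (simplex_realization (\<sigma> j))) UNIV"
  using subtopology_product_topology[of "\<lambda>j. fin_vecs_topology (I j)" UNIV "\<lambda>j. simplex_realization (\<sigma> j)"]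
  by (simp add: prod_simplex_realization_def PiE_UNIV_domain subtopology_fin_vecs_topology_simplex assms)

lemma simplicial_complexD:
  assumes "simplicial_complex I K" "\<rho> \<in> K"
  shows "finite \<rho>" "\<rho> \<subseteq> I"
  using assms by (auto simp: simplicial_complex_def simplices_def)

lemma prod_complexD:
  assumes "prod_complex I P" "\<sigma> \<in> P"
  shows "finite (\<sigma> j)" "\<sigma> j \<noteq> {}" "\<sigma> j \<subseteq> I j"
  using assms by (auto simp: prod_complex_def simplices_def Pi_iff)

lemma simplices_subset_fin_vecs:
  assumes "simplicial_complex I K"
  shows "\<Union>(simplex_realization ` K) \<subseteq> topspace (fin_vecs_topology I)"
  unfolding topspace_fin_vecs_topology
  using simplicial_complexD(2)[OF assms] by (intro UN_least simplex_realization_subset)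

lemma continuous_map_into_realization:
  assumes K: "simplicial_complex I K" "\<rho> \<in> K"
    and f: "continuous_map X euclidean f" "f \<in> topspace X \<rightarrow> simplex_realization \<rho>"
  shows "continuous_map X (realization I K) f"
proof -
  have "subtopology (realization I K) (simplex_realization \<rho>) = top_of_set (simplex_realization \<rho>)"
    unfolding realization_def using K
    by (simp add: subtopology_coherent_topology subtopology_fin_vecs_topology_simplex
        simplicial_complexD[OF K])
  then show ?thesis
    using f by (metis continuous_map_in_subtopology)
qed

lemma continuous_map_from_realization:
  assumes K: "simplicial_complex I K"
    and f: "\<And>\<rho>. \<rho> \<in> K \<Longrightarrow> continuous_map (top_of_set (simplex_realization \<rho>)) Y f"
  shows "continuous_map (realization I K) Y f"
  unfolding realization_def
proof (rule continuous_map_coherent_topology[OF simplices_subset_fin_vecs[OF K]])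
  fix C assume "C \<in> simplex_realization ` K"
  then show "continuous_map (subtopology (fin_vecs_topology I) C) Y f"
    using f simplicial_complexD[OF K] by (auto simp: subtopology_fin_vecs_topology_simplex)
qed

lemma continuous_map_from_interval_times_realization:
  assumes K: "simplicial_complex I K"
    and f: "\<And>\<rho>. \<rho> \<in> K \<Longrightarrow> continuous_map (top_of_set ({0..1::real} \<times> simplex_realization \<rho>)) Y f"
  shows "continuous_map (prod_topology (top_of_set {0..1}) (realization I K)) Y f"
  unfolding realization_def
proof (rule continuous_map_prod_coherent_topology[OF simplices_subset_fin_vecs[OF K]])
  show "locally_compact_space (top_of_set {0..1::real})"
    by (simp add: compact_imp_locally_compact_space compact_space_subtopology)
  show "Hausdorff_space (top_of_set {0..1::real}) \<or> regular_space (top_of_set {0..1::real})"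
    by (simp add: Hausdorff_space_subtopology)
  fix C assume "C \<in> simplex_realization ` K"
  then show "continuous_map (prod_topology (top_of_set {0..1}) (subtopology (fin_vecs_topology I) C)) Y f"
    using f simplicial_complexD[OF K] by (auto simp: subtopology_fin_vecs_topology_simplex)
qed

lemma continuous_map_into_prod_realization:
  assumes P: "prod_complex I P" "\<sigma> \<in> P"
    and f: "\<And>j. continuous_map X euclidean (\<lambda>x. f x j)"
      "\<And>j x. x \<in> topspace X \<Longrightarrow> f x j \<in> simplex_realization (\<sigma> j)"
  shows "continuous_map X (prod_realization I P) f"
proof -
  have "subtopology (prod_realization I P) (prod_simplex_realization \<sigma>)
      = product_topology (\<lambda>j. top_of_set (simplex_realization (\<sigma> j))) UNIV"
    unfolding prod_realization_def using P
    by (simp add: subtopology_coherent_topology subtopology_product_fin_vecs_topology prod_complexD[OF P])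
  moreover have "continuous_map X (product_topology (\<lambda>j. top_of_set (simplex_realization (\<sigma> j))) UNIV) f"
    using f by (auto simp: continuous_map_componentwise_UNIV continuous_map_in_subtopology)
  ultimately show ?thesis
    by (metis continuous_map_into_fulltopology)
qed

lemma continuous_map_from_prod_realization:
  assumes P: "prod_complex I P"
    and f: "\<And>\<sigma>. \<sigma> \<in> P \<Longrightarrow>
      continuous_map (product_topology (\<lambda>j. top_of_set (simplex_realization (\<sigma> j))) UNIV) Y f"
  shows "continuous_map (prod_realization I P) Y f"
  unfolding prod_realization_def
proof (rule continuous_map_coherent_topology)
  have "prod_simplex_realization \<sigma> \<subseteq> Pi UNIV (\<lambda>j. fin_vecs (I j))" if "\<sigma> \<in> P" for \<sigma>
    unfolding prod_simplex_realization_def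
    using prod_complexD(3)[OF P that] by (intro Pi_mono simplex_realization_subset)
  then show "\<Union>(prod_simplex_realization ` P)
      \<subseteq> topspace (product_topology (\<lambda>j. fin_vecs_topology (I j)) UNIV)"
    by (auto simp: topspace_fin_vecs_topology PiE_UNIV_domain)
  fix C assume "C \<in> prod_simplex_realization ` P"
  then show "continuous_map (subtopology (product_topology (\<lambda>j. fin_vecs_topology (I j)) UNIV) C) Y f"
    using f prod_complexD[OF P] by (auto simp: subtopology_product_fin_vecs_topology)
qed

section \<open>Marginals and independent couplings\<close>

lemma finite_Pi_UNIV:
  fixes \<sigma> :: "'m::finite \<Rightarrow> 'a set"
  assumes "\<And>j. finite (\<sigma> j)"
  shows "finite (Pi UNIV \<sigma>)"
  using finite_PiE[of UNIV \<sigma>] assms by (simp add: PiE_UNIV_domain)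

lemma squash_eq_sum:
  assumes "finite S" "Poly_Mapping.keys x \<subseteq> S"
  shows "squash x j = (\<Sum>i\<in>S. Poly_Mapping.lookup x i *\<^sub>R basis_vec (i j))"
  unfolding squash_def using assms by (intro sum.mono_neutral_left) (auto simp: in_keys_iff)

lemma squash_in_simplex_realization:
  assumes "finite \<rho>" "\<rho> \<subseteq> Pi UNIV \<sigma>" "x \<in> simplex_realization \<rho>"
  shows "squash x j \<in> simplex_realization (\<sigma> j)"
proof -
  have x: "Poly_Mapping.keys x \<subseteq> \<rho>" "\<And>i. 0 \<le> Poly_Mapping.lookup x i"
    "(\<Sum>i\<in>\<rho>. Poly_Mapping.lookup x i) = 1"
    using assms by (auto simp: simplex_realization_eq)
  have "(\<Sum>i\<in>\<rho>. Poly_Mapping.lookup x i *\<^sub>R basis_vec (i j)) \<in> simplex_realization (\<sigma> j)"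
    unfolding simplex_realization_def
    using x assms by (intro convex_sum) (auto intro!: hull_inc simp: Pi_iff subset_iff)
  then show ?thesis using squash_eq_sum[OF assms(1) x(1)] by simp
qed

lemma continuous_on_squash:
  assumes "finite \<rho>"
  shows "continuous_on (simplex_realization \<rho>) (\<lambda>x. squash x j)"
proof -
  have "continuous_on (simplex_realization \<rho>)
      (\<lambda>x. \<Sum>i\<in>\<rho>. Poly_Mapping.lookup x i *\<^sub>R basis_vec (i j))"
    by (intro continuous_intros continuous_on_lookup)
  moreover have "squash x j = (\<Sum>i\<in>\<rho>. Poly_Mapping.lookup x i *\<^sub>R basis_vec (i j))"
    if "x \<in> simplex_realization \<rho>" for x
    using that assms by (intro squash_eq_sum) (auto simp: simplex_realization_eq)
  ultimately show ?thesis by (simp cong: continuous_on_cong)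
qed

definition independent_coupling :: "('m::finite \<Rightarrow> ('a \<Rightarrow>\<^sub>0 real)) \<Rightarrow> (('m \<Rightarrow> 'a) \<Rightarrow>\<^sub>0 real)" where
  "independent_coupling x = (\<Sum>i\<in>Pi UNIV (\<lambda>j. Poly_Mapping.keys (x j)).
     (\<Prod>j\<in>UNIV. Poly_Mapping.lookup (x j) (i j)) *\<^sub>R basis_vec i)"

lemma lookup_independent_coupling:
  "Poly_Mapping.lookup (independent_coupling x) i = (\<Prod>j\<in>UNIV. Poly_Mapping.lookup (x j) (i j))"
proof -
  have "finite (Pi UNIV (\<lambda>j. Poly_Mapping.keys (x j)))"
    by (rule finite_Pi_UNIV) simp
  then show ?thesis
    by (auto simp: independent_coupling_def lookup_sum lookup_scaleR lookup_basis_vec in_keys_iff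
        if_distrib[of "\<lambda>t. _ * t"] sum.delta cong: if_cong)
qed

lemma keys_independent_coupling:
  assumes "\<And>j. Poly_Mapping.keys (x j) \<subseteq> \<sigma> j"
  shows "Poly_Mapping.keys (independent_coupling x) \<subseteq> Pi UNIV \<sigma>"
  using assms by (auto simp: in_keys_iff[of _ "independent_coupling x"] lookup_independent_coupling
      subset_iff in_keys_iff)

lemma independent_coupling_in_simplex_realization:
  assumes fin: "\<And>j. finite (\<sigma> j)" and x: "\<And>j. x j \<in> simplex_realization (\<sigma> j)"
  shows "independent_coupling x \<in> simplex_realization (Pi UNIV \<sigma>)"
proof -
  have xj: "Poly_Mapping.keys (x j) \<subseteq> \<sigma> j" "0 \<le> Poly_Mapping.lookup (x j) i"
    "(\<Sum>i\<in>\<sigma> j. Poly_Mapping.lookup (x j) i) = 1" for i j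
    using x[of j] by (auto simp: simplex_realization_eq fin)
  have "(\<Sum>i\<in>Pi UNIV \<sigma>. \<Prod>j\<in>UNIV. Poly_Mapping.lookup (x j) (i j))
      = (\<Prod>j\<in>UNIV. \<Sum>i\<in>\<sigma> j. Poly_Mapping.lookup (x j) i)"
    using prod_sum_PiE[of UNIV \<sigma> "\<lambda>j. Poly_Mapping.lookup (x j)"] fin
    by (simp add: PiE_UNIV_domain)
  then show ?thesis
    using keys_independent_coupling[of x \<sigma>] xj
    by (auto simp: simplex_realization_eq finite_Pi_UNIV fin lookup_independent_coupling
        intro: prod_nonneg)
qed

lemma squash_independent_coupling:
  assumes fin: "\<And>j. finite (\<sigma> j)" and x: "\<And>j. x j \<in> simplex_realization (\<sigma> j)"
  shows "squash (independent_coupling x) = x"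
proof (rule ext, rule poly_mapping_eqI)
  fix j a
  have xj: "Poly_Mapping.keys (x j) \<subseteq> \<sigma> j" "(\<Sum>i\<in>\<sigma> j. Poly_Mapping.lookup (x j) i) = 1" for j
    using x[of j] by (auto simp: simplex_realization_eq fin)
  \<comment> \<open>Restricting the \<open>j\<close>-th coordinate to the value \<open>a\<close> is absorbed into the \<open>j\<close>-th factor, so
    that the sum over the product set still factorizes.\<close>
  define F where "F k b = (if k = j \<and> b \<noteq> a then 0 else Poly_Mapping.lookup (x k) b)" for k b
  have "Poly_Mapping.lookup (squash (independent_coupling x) j) a
      = (\<Sum>i\<in>Pi UNIV \<sigma>. (\<Prod>k\<in>UNIV. Poly_Mapping.lookup (x k) (i k)) * (if a = i j then 1 else 0))"
    by (simp add: squash_eq_sum[OF finite_Pi_UNIV[OF fin] keys_independent_coupling[OF xj(1)]]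
        lookup_sum lookup_scaleR lookup_basis_vec lookup_independent_coupling)
  also have "\<dots> = (\<Sum>i\<in>Pi UNIV \<sigma>. \<Prod>k\<in>UNIV. F k (i k))"
  proof (rule sum.cong[OF refl])
    fix i
    show "(\<Prod>k\<in>UNIV. Poly_Mapping.lookup (x k) (i k)) * (if a = i j then 1 else 0)
      = (\<Prod>k\<in>UNIV. F k (i k))"
    proof (cases "a = i j")
      case True
      then show ?thesis by (auto simp: F_def intro!: prod.cong)
    next
      case False
      then have "F j (i j) = 0" by (simp add: F_def)
      then have "(\<Prod>k\<in>UNIV. F k (i k)) = 0" by (intro prod_zero) auto
      then show ?thesis using False by simp
    qed
  qed
  also have "\<dots> = (\<Prod>k\<in>UNIV. \<Sum>b\<in>\<sigma> k. F k b)"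
    using prod_sum_PiE[of UNIV \<sigma> F] fin by (simp add: PiE_UNIV_domain)
  also have "\<dots> = (\<Prod>k\<in>UNIV. if k = j then Poly_Mapping.lookup (x j) a else 1)"
  proof (rule prod.cong[OF refl])
    fix k
    have "(\<Sum>b\<in>\<sigma> j. F j b) = (\<Sum>b\<in>\<sigma> j. if b = a then Poly_Mapping.lookup (x j) b else 0)"
      by (auto simp: F_def intro!: sum.cong)
    also have "\<dots> = Poly_Mapping.lookup (x j) a"
      using xj(1)[of j] fin[of j] by (auto simp: sum.delta in_keys_iff)
    finally show "(\<Sum>b\<in>\<sigma> k. F k b) = (if k = j then Poly_Mapping.lookup (x j) a else 1)"
      using xj(2)[of k] by (cases "k = j") (simp_all add: F_def)
  qed
  also have "\<dots> = Poly_Mapping.lookup (x j) a" by simp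
  finally show "Poly_Mapping.lookup (squash (independent_coupling x) j) a
    = Poly_Mapping.lookup (x j) a" .
qed

lemma continuous_map_independent_coupling:
  fixes \<sigma> :: "'m::finite \<Rightarrow> 'a set"
  assumes fin: "\<And>j. finite (\<sigma> j)"
  shows "continuous_map (product_topology (\<lambda>j. top_of_set (simplex_realization (\<sigma> j))) UNIV)
    euclidean independent_coupling" (is "continuous_map ?X _ _")
proof (rule continuous_map_eq)
  have coord: "continuous_map ?X euclideanreal (\<lambda>x. Poly_Mapping.lookup (x j) a)" for j a
  proof -
    have "continuous_map ?X (top_of_set (simplex_realization (\<sigma> j))) (\<lambda>x. x j)"
      by (rule continuous_map_product_projection) simp
    moreover have "continuous_map (top_of_set (simplex_realization (\<sigma> j))) euclideanreal
        (\<lambda>y. Poly_Mapping.lookup y a)"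
      by (simp add: continuous_on_lookup)
    ultimately have "continuous_map ?X euclideanreal ((\<lambda>y. Poly_Mapping.lookup y a) \<circ> (\<lambda>x. x j))"
      by (rule continuous_map_compose)
    then show ?thesis by (simp add: o_def)
  qed
  have scale: "continuous_map ?X euclidean (\<lambda>x. c x *\<^sub>R v)"
    if "continuous_map ?X euclideanreal c" for c and v :: "('m \<Rightarrow> 'a) \<Rightarrow>\<^sub>0 real"
  proof -
    have "continuous_map euclideanreal euclidean (\<lambda>t. t *\<^sub>R v)"
      by (simp add: continuous_intros)
    from continuous_map_compose[OF that this] show ?thesis by (simp add: o_def)
  qed
  show "continuous_map ?X euclidean (\<lambda>x. \<Sum>i\<in>Pi UNIV \<sigma>.
      (\<Prod>j\<in>UNIV. Poly_Mapping.lookup (x j) (i j)) *\<^sub>R basis_vec i)"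
    by (intro continuous_map_sum scale continuous_map_prod coord finite_Pi_UNIV fin finite)
  fix x assume "x \<in> topspace ?X"
  then have "Poly_Mapping.keys (x j) \<subseteq> \<sigma> j" for j
    by (auto simp: PiE_UNIV_domain Pi_iff simplex_realization_eq fin)
  from sum_lookup_scaleR_basis_vec[OF finite_Pi_UNIV[OF fin] keys_independent_coupling[OF this]]
  show "(\<Sum>i\<in>Pi UNIV \<sigma>. (\<Prod>j\<in>UNIV. Poly_Mapping.lookup (x j) (i j)) *\<^sub>R basis_vec i)
    = independent_coupling x"
    by (simp add: lookup_independent_coupling)
qed

section \<open>The squashing map\<close>

lemma Pi_in_simplexification:
  assumes P: "prod_complex I P" "\<sigma> \<in> P"
  shows "Pi UNIV \<sigma> \<in> simplexification I P"
proof -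
  have "Pi UNIV \<sigma> \<subseteq> Pi UNIV I"
    using prod_complexD(3)[OF P] by (intro Pi_mono)
  then show ?thesis
    using P prod_complexD[OF P] by (auto simp: simplexification_def simplices_def finite_Pi_UNIV Pi_eq_empty)
qed

lemma simplexificationE:
  assumes "\<rho> \<in> simplexification I P"
  obtains \<sigma> where "\<sigma> \<in> P" "finite \<rho>" "\<rho> \<subseteq> Pi UNIV \<sigma>"
  using assms by (auto simp: simplexification_def simplices_def)

lemma squashing_map_eq:
  assumes "\<rho> \<in> simplexification I P" "x \<in> simplex_realization \<rho>"
  shows "squashing_map I P x = squash x"
  using assms by (auto simp: squashing_map_def)

lemma simplex_realization_mono: "\<rho> \<subseteq> \<tau> \<Longrightarrow> simplex_realization \<rho> \<subseteq> simplex_realization \<tau>"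
  unfolding simplex_realization_def by (intro hull_mono image_mono)

lemma continuous_map_squashing_map:
  assumes P: "prod_complex I P"
  shows "continuous_map (realization (Pi UNIV I) (simplexification I P)) (prod_realization I P)
    (squashing_map I P)"
proof (rule continuous_map_from_realization[OF simplicial_complex_simplexification])
  fix \<rho> assume \<rho>: "\<rho> \<in> simplexification I P"
  then obtain \<sigma> where \<sigma>: "\<sigma> \<in> P" "finite \<rho>" "\<rho> \<subseteq> Pi UNIV \<sigma>" by (rule simplexificationE)
  have "continuous_map (top_of_set (simplex_realization \<rho>)) (prod_realization I P) squash"
    by (rule continuous_map_into_prod_realization[OF P \<sigma>(1)])
      (use \<sigma> in \<open>auto simp: continuous_on_squash squash_in_simplex_realization\<close>)
  then show "continuous_map (top_of_set (simplex_realization \<rho>)) (prod_realization I P)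
      (squashing_map I P)"
    by (rule continuous_map_eq) (simp add: squashing_map_eq[OF \<rho>])
qed

lemma continuous_map_independent_coupling_realization:
  assumes P: "prod_complex I P"
  shows "continuous_map (prod_realization I P) (realization (Pi UNIV I) (simplexification I P))
    independent_coupling"
proof (rule continuous_map_from_prod_realization[OF P])
  fix \<sigma> assume \<sigma>: "\<sigma> \<in> P"
  note fin = prod_complexD(1)[OF P \<sigma>]
  show "continuous_map (product_topology (\<lambda>j. top_of_set (simplex_realization (\<sigma> j))) UNIV)
      (realization (Pi UNIV I) (simplexification I P)) independent_coupling"
    by (rule continuous_map_into_realization[OF simplicial_complex_simplexification
          Pi_in_simplexification[OF P \<sigma>] continuous_map_independent_coupling[OF fin]])
      (auto simp: PiE_UNIV_domain intro!: independent_coupling_in_simplex_realization fin)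
qed

text \<open>
  A simplex \<open>\<rho>\<close> of the simplexification need not be a product, so the product of the marginals of
  a point of \<open>\<bar>\<rho>\<bar>\<close> may leave \<open>\<bar>\<rho>\<bar>\<close>.  It stays in \<open>\<bar>\<sigma>\<^sub>1 \<times> \<dots> \<times> \<sigma>\<^sub>m\<bar>\<close> for every \<open>\<sigma> \<in> P\<close>
  with \<open>\<rho> \<subseteq> \<sigma>\<^sub>1 \<times> \<dots> \<times> \<sigma>\<^sub>m\<close>, and this larger cell contains the whole segment.
\<close>

lemma homotopic_independent_coupling_squashing_map:
  assumes P: "prod_complex I P"
  defines "X \<equiv> realization (Pi UNIV I) (simplexification I P)"
  shows "homotopic_with (\<lambda>_. True) X X (independent_coupling \<circ> squashing_map I P) id"
proof -
  define h where "h = (\<lambda>(t::real, x). (1 - t) *\<^sub>R independent_coupling (squashing_map I P x) + t *\<^sub>R x)"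
  have "continuous_map (prod_topology (top_of_set {0..1}) X) X h"
    unfolding X_def
  proof (rule continuous_map_from_interval_times_realization[OF simplicial_complex_simplexification])
    fix \<rho> assume \<rho>: "\<rho> \<in> simplexification I P"
    then obtain \<sigma> where \<sigma>: "\<sigma> \<in> P" "finite \<rho>" "\<rho> \<subseteq> Pi UNIV \<sigma>" by (rule simplexificationE)
    note fin = prod_complexD(1)[OF P \<sigma>(1)]
    have "continuous_map (top_of_set (simplex_realization \<rho>))
        (product_topology (\<lambda>j. top_of_set (simplex_realization (\<sigma> j))) UNIV) squash"
      using \<sigma> by (auto simp: continuous_map_componentwise_UNIV continuous_map_in_subtopology
          continuous_on_squash squash_in_simplex_realization)
    from continuous_map_compose[OF this continuous_map_independent_coupling[OF fin]]
    have "continuous_on (simplex_realization \<rho>) (\<lambda>x. independent_coupling (squash x))"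
      by (simp add: o_def)
    then have cont: "continuous_on (simplex_realization \<rho>)
        (\<lambda>x. independent_coupling (squashing_map I P x))"
      by (rule continuous_on_eq) (simp add: squashing_map_eq[OF \<rho>])
    have "continuous_on ({0..1} \<times> simplex_realization \<rho>)
        (\<lambda>p. independent_coupling (squashing_map I P (snd p)))"
      by (rule continuous_on_compose2[OF cont]) (auto intro: continuous_on_snd continuous_on_id)
    then have "continuous_on ({0..1} \<times> simplex_realization \<rho>) h"
      unfolding h_def case_prod_beta by (intro continuous_intros)
    moreover have "h (t, x) \<in> simplex_realization (Pi UNIV \<sigma>)"
      if "t \<in> {0..1}" "x \<in> simplex_realization \<rho>" for t x
    proof -
      have "independent_coupling (squashing_map I P x) \<in> simplex_realization (Pi UNIV \<sigma>)"
        using squash_in_simplex_realization[OF \<sigma>(2,3) that(2)]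
        by (simp add: squashing_map_eq[OF \<rho> that(2)] independent_coupling_in_simplex_realization fin)
      moreover have "x \<in> simplex_realization (Pi UNIV \<sigma>)"
        using that simplex_realization_mono[OF \<sigma>(3)] by blast
      moreover have "convex (simplex_realization (Pi UNIV \<sigma>))"
        by (simp add: simplex_realization_def)
      ultimately show ?thesis
        using that(1) by (auto simp: h_def intro!: convexD)
    qed
    ultimately show "continuous_map (top_of_set ({0..1} \<times> simplex_realization \<rho>))
        (realization (Pi UNIV I) (simplexification I P)) h"
      by (intro continuous_map_into_realization[OF simplicial_complex_simplexification
            Pi_in_simplexification[OF P \<sigma>(1)]]) auto
  qed
  then show ?thesis
    unfolding homotopic_with_def by (intro exI[of _ h]) (auto simp: h_def)
qed

theorem theorem5p1p7:
  fixes I :: "'m::finite \<Rightarrow> 'a set" and P :: "('m \<Rightarrow> 'a set) set"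
  assumes "prod_complex I P"
  shows "homotopy_equivalence
           (realization (Pi UNIV I) (simplexification I P))
           (prod_realization I P)
           (squashing_map I P)"
  unfolding homotopy_equivalence_def
proof (intro conjI exI[of _ independent_coupling])
  let ?X = "realization (Pi UNIV I) (simplexification I P)"
  let ?Y = "prod_realization I P"
  show sq: "continuous_map ?X ?Y (squashing_map I P)"
    by (rule continuous_map_squashing_map[OF assms])
  show ic: "continuous_map ?Y ?X independent_coupling"
    by (rule continuous_map_independent_coupling_realization[OF assms])
  show "homotopic_with (\<lambda>_. True) ?X ?X (independent_coupling \<circ> squashing_map I P) id"
    by (rule homotopic_independent_coupling_squashing_map[OF assms])
  have "squashing_map I P (independent_coupling x) = x" if x: "x \<in> topspace ?Y" for x
  proof -
    obtain \<sigma> where \<sigma>: "\<sigma> \<in> P" "\<And>j. x j \<in> simplex_realization (\<sigma> j)"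
      using x unfolding topspace_prod_realization[OF assms] prod_simplex_realization_def by blast
    note fin = prod_complexD(1)[OF assms \<sigma>(1)]
    show ?thesis
      using squashing_map_eq[OF Pi_in_simplexification[OF assms \<sigma>(1)]
          independent_coupling_in_simplex_realization[OF fin \<sigma>(2)]]
        squash_independent_coupling[OF fin \<sigma>(2)]
      by simp
  qed
  then show "homotopic_with (\<lambda>_. True) ?Y ?Y (squashing_map I P \<circ> independent_coupling) id"
    by (intro homotopic_with_equal) (auto intro: continuous_map_compose[OF ic sq])
qed

end
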